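(* Let $G=\{g_1,\ldots,g_n\}$ be a finite group. Let $(\xi_m)_{m\ge 1}$ be independent and identically distributed $G$-valued random variables whose support is $G$ (that is, $\mathbb{P}[\xi_m=g]>0$ for every $g\in G$). Let $(X_m)_{m\ge 1}$ be the $G$-valued stochastic process defined by $X_1=\xi_1$ and $X_{m+1}=X_m\xi_{m+1}$ for $m\ge 1$. Then the limit $$\lim_{m\to\infty}\mathcal{L}(X_m)=\mathcal{L}$$ exists, and $\mathcal{L}$ is the uniform distribution over $G$.
   Context: For a random variable $X$, $\mathcal{L}(X)$ denotes its distribution (law). Since $G$ is finite, convergence of laws means convergence of $\mathbb{P}[X_m=g]$ as $m\to\infty$ for each $g\in G$. The uniform distribution over $G$ assigns probability $1/n$ to each element, where $n=|G|$. *)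

theory Defs
  imports "HOL-Probability.Probability" "HOL-Algebra.Group"
begin

definition law :: "'w measure \<Rightarrow> ('a, 'b) monoid_scheme \<Rightarrow> ('w \<Rightarrow> 'a) \<Rightarrow> 'a measure" where
  "law M G Y = distr M (count_space (carrier G)) Y"

text \<open>
  Convergence of laws on a finite group is pointwise convergence of the probabilities of singletons.
  The limit is required to be a probability measure on the same measurable space, so that it is
  unique (see \<open>laws_tendsto_unique\<close> below).
\<close>

definition laws_tendsto ::
    "('a, 'b) monoid_scheme \<Rightarrow> (nat \<Rightarrow> 'a measure) \<Rightarrow> 'a measure \<Rightarrow> bool" where
  "laws_tendsto G \<mu> L \<longleftrightarrow>
     prob_space L \<and> sets L = sets (count_space (carrier G)) \<and>
     (\<forall>g \<in> carrier G. (\<lambda>m. measure (\<mu> m) {g}) \<longlonglongrightarrow> measure L {g})"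

lemma laws_tendsto_unique:
  assumes fin: "finite (carrier G)"
    and L: "laws_tendsto G \<mu> L" and L': "laws_tendsto G \<mu> L'"
  shows "L = L'"
proof (rule measure_eqI_finite[where A = "carrier G"])
  show "sets L = Pow (carrier G)" "sets L' = Pow (carrier G)"
    using L L' by (simp_all add: laws_tendsto_def)
  show "finite (carrier G)" by fact
next
  fix g assume g: "g \<in> carrier G"
  interpret L: prob_space L using L by (simp add: laws_tendsto_def)
  interpret L': prob_space L' using L' by (simp add: laws_tendsto_def)
  have "measure L {g} = measure L' {g}"
    using L L' g by (auto simp: laws_tendsto_def intro: LIMSEQ_unique)
  then show "emeasure L {g} = emeasure L' {g}"
    by (simp add: L.emeasure_eq_measure L'.emeasure_eq_measure)
qed

end

theory Submission
  imports Defs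
begin

text \<open>
  Let \<open>p\<^sub>m(g)\<close> be the probability of \<open>X\<^sub>m = g\<close> and \<open>q(g)\<close> the probability that a step equals \<open>g\<close>.
  Since \<open>X\<^sub>m\<close> is a function of the first \<open>m\<close> steps, it is independent of the next one, which gives the
  convolution recurrence \<open>p\<^sub>m\<^sub>+\<^sub>1(g) = \<Sum>\<^sub>h p\<^sub>m(h) q(h\<inverse>g)\<close>.

  The uniform distribution is a fixed point of this recurrence, because \<open>h \<mapsto> h\<inverse>g\<close> permutes the
  group. So the deviation \<open>d\<^sub>m = p\<^sub>m - 1/n\<close> satisfies the same recurrence, and in addition its values
  sum to \<open>0\<close>. Let \<open>c > 0\<close> be the least value of \<open>q\<close>, which is positive because the steps have full
  support. Subtracting \<open>c\<close> from \<open>q\<close> does not change the convolution with \<open>d\<^sub>m\<close>, and the reduced weights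
  \<open>q - c\<close> are nonnegative with total mass \<open>1 - nc < 1\<close>. Every step therefore shrinks the supremum
  norm of the deviation at least by the factor \<open>1 - nc\<close>, and the convergence is geometric.
\<close>

section \<open>Convolution powers on a finite group\<close>

lemma (in group) bij_betw_inv_mult_left:
  assumes "g \<in> carrier G"
  shows "bij_betw (\<lambda>h. inv h \<otimes> g) (carrier G) (carrier G)"
  by (rule bij_betw_byWitness[where f' = "\<lambda>k. g \<otimes> inv k"])
    (use assms in \<open>auto simp: inv_mult_group m_assoc[symmetric]\<close>,
      use assms in \<open>simp add: m_assoc\<close>)

text \<open>
  The weights may be lowered by a constant \<open>c\<close> because the signed function \<open>d\<close> has total mass \<open>0\<close>.
  What remains is a nonnegative kernel of mass \<open>1 - nc\<close>, which bounds the supremum norm.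
\<close>

lemma (in group) abs_convolution_le:
  fixes d q :: "'a \<Rightarrow> real"
  assumes d_sum: "(\<Sum>h\<in>carrier G. d h) = 0"
    and d_le: "\<And>h. h \<in> carrier G \<Longrightarrow> \<bar>d h\<bar> \<le> B"
    and q_sum: "(\<Sum>h\<in>carrier G. q h) = 1"
    and q_ge: "\<And>h. h \<in> carrier G \<Longrightarrow> c \<le> q h"
    and g: "g \<in> carrier G"
  shows "\<bar>\<Sum>h\<in>carrier G. d h * q (inv h \<otimes> g)\<bar> \<le> (1 - real (card (carrier G)) * c) * B"
proof -
  have mass: "(\<Sum>h\<in>carrier G. q (inv h \<otimes> g) - c) = 1 - real (card (carrier G)) * c"
    using sum.reindex_bij_betw[OF bij_betw_inv_mult_left[OF g], of q] q_sum
    by (simp add: sum_subtractf)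
  have "(\<Sum>h\<in>carrier G. d h * q (inv h \<otimes> g)) = (\<Sum>h\<in>carrier G. d h * (q (inv h \<otimes> g) - c))"
    using d_sum by (simp add: right_diff_distrib sum_subtractf flip: sum_distrib_right)
  also have "\<bar>\<dots>\<bar> \<le> (\<Sum>h\<in>carrier G. \<bar>d h * (q (inv h \<otimes> g) - c)\<bar>)"
    by (rule sum_abs)
  also have "\<dots> \<le> (\<Sum>h\<in>carrier G. B * (q (inv h \<otimes> g) - c))"
  proof (rule sum_mono)
    fix h assume h: "h \<in> carrier G"
    then have "0 \<le> q (inv h \<otimes> g) - c"
      using q_ge[of "inv h \<otimes> g"] g by simp
    then show "\<bar>d h * (q (inv h \<otimes> g) - c)\<bar> \<le> B * (q (inv h \<otimes> g) - c)"
      using d_le[OF h] by (simp add: abs_mult mult_right_mono)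
  qed
  also have "\<dots> = (1 - real (card (carrier G)) * c) * B"
    by (simp add: mass mult.commute flip: sum_distrib_left)
  finally show ?thesis .
qed

text \<open>
  The values \<open>p m h\<close> need not be nonnegative: the contraction acts on any start of total mass \<open>1\<close>,
  and the constant \<open>B\<close> is the supremum norm of its initial deviation.
\<close>

lemma (in group) convolution_recurrence_tendsto_uniform:
  fixes p :: "nat \<Rightarrow> 'a \<Rightarrow> real" and q :: "'a \<Rightarrow> real"
  assumes fin: "finite (carrier G)"
    and p_sum: "\<And>m. (\<Sum>h\<in>carrier G. p m h) = 1"
    and q_sum: "(\<Sum>h\<in>carrier G. q h) = 1"
    and q_pos: "\<And>h. h \<in> carrier G \<Longrightarrow> 0 < q h"
    and rec: "\<And>m g. g \<in> carrier G \<Longrightarrow> p (Suc m) g = (\<Sum>h\<in>carrier G. p m h * q (inv h \<otimes> g))"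
    and g: "g \<in> carrier G"
  shows "(\<lambda>m. p m g) \<longlonglongrightarrow> 1 / real (card (carrier G))"
proof -
  define n where "n = real (card (carrier G))"
  define c where "c = Min (q ` carrier G)"
  define d where "d = (\<lambda>m h. p m h - 1 / n)"
  define B where "B = Max ((\<lambda>h. \<bar>d 0 h\<bar>) ` carrier G)"
  have ne: "carrier G \<noteq> {}" using g by auto
  have n: "n > 0" using fin ne by (simp add: n_def card_gt_0_iff)
  have c_le: "c \<le> q h" if "h \<in> carrier G" for h
    using fin that by (simp add: c_def)
  have c: "c > 0" using fin ne q_pos by (simp add: c_def)
  have "n * c \<le> (\<Sum>h\<in>carrier G. q h)"
    using sum_bounded_below[of "carrier G" c q] c_le by (simp add: n_def)
  then have nc: "n * c \<le> 1" by (simp add: q_sum)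
  have d_sum: "(\<Sum>h\<in>carrier G. d m h) = 0" for m
    using n by (simp add: d_def sum_subtractf p_sum flip: n_def)
  have d_rec: "d (Suc m) h = (\<Sum>k\<in>carrier G. d m k * q (inv k \<otimes> h))"
    if h: "h \<in> carrier G" for m h
    using sum.reindex_bij_betw[OF bij_betw_inv_mult_left[OF h], of q] q_sum rec[OF h]
    by (simp add: d_def left_diff_distrib sum_subtractf flip: sum_divide_distrib)
  have bound: "\<bar>d m h\<bar> \<le> (1 - n * c) ^ m * B" if "h \<in> carrier G" for m h
    using that
  proof (induction m arbitrary: h)
    case 0
    then show ?case using fin by (simp add: B_def)
  next
    case (Suc m)
    show ?case
      using abs_convolution_le[OF d_sum[of m] Suc.IH q_sum c_le Suc.prems]
      by (simp add: d_rec[OF Suc.prems] mult.assoc flip: n_def)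
  qed
  have "(\<lambda>m. (1 - n * c) ^ m * B) \<longlonglongrightarrow> 0"
    using n c nc by (intro tendsto_mult_left_zero LIMSEQ_power_zero) simp
  then have "(\<lambda>m. d m g) \<longlonglongrightarrow> 0"
    by (rule Lim_null_comparison[rotated]) (simp add: bound g)
  then show ?thesis
    by (simp add: d_def LIM_zero_iff flip: n_def)
qed

section \<open>Independence of the present state and the next step\<close>

text \<open>
  Unfolding the recursion writes the state at time \<open>m\<close> as a function of the steps \<open>1, \<dots>, m\<close> alone;
  this is what transfers independence from the steps to the process.
\<close>

lemma random_recursion_factors:
  assumes \<xi>: "\<And>i \<omega>. 1 \<le> i \<Longrightarrow> \<omega> \<in> \<Omega> \<Longrightarrow> \<xi> i \<omega> \<in> S"
    and f: "\<And>a b. a \<in> S \<Longrightarrow> b \<in> S \<Longrightarrow> f a b \<in> S"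
    and X_1: "\<And>\<omega>. \<omega> \<in> \<Omega> \<Longrightarrow> X 1 \<omega> = \<xi> 1 \<omega>"
    and X_Suc: "\<And>m \<omega>. 1 \<le> m \<Longrightarrow> \<omega> \<in> \<Omega> \<Longrightarrow> X (m + 1) \<omega> = f (X m \<omega>) (\<xi> (m + 1) \<omega>)"
    and m: "1 \<le> (m::nat)"
  shows "\<exists>F \<in> (\<Pi>\<^sub>E i\<in>{1..m}. S) \<rightarrow> S. \<forall>\<omega>\<in>\<Omega>. X m \<omega> = F (\<lambda>i\<in>{1..m}. \<xi> i \<omega>)"
  using m
proof (induction m rule: dec_induct)
  case base
  show ?case
    by (rule bexI[where x = "\<lambda>x. x 1"]) (auto simp: X_1[unfolded One_nat_def])
next
  case (step m)
  then obtain F where F: "F \<in> (\<Pi>\<^sub>E i\<in>{1..m}. S) \<rightarrow> S"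
    and X: "\<And>\<omega>. \<omega> \<in> \<Omega> \<Longrightarrow> X m \<omega> = F (\<lambda>i\<in>{1..m}. \<xi> i \<omega>)" by blast
  define F' where "F' = (\<lambda>x. f (F (restrict x {1..m})) (x (Suc m)))"
  have "F' x \<in> S" if "x \<in> (\<Pi>\<^sub>E i\<in>{1..Suc m}. S)" for x
  proof -
    have "restrict x {1..m} \<in> (\<Pi>\<^sub>E i\<in>{1..m}. S)" "x (Suc m) \<in> S"
      using that by (auto simp: PiE_iff)
    then show ?thesis unfolding F'_def by (intro f funcset_mem[OF F])
  qed
  moreover have "X (Suc m) \<omega> = F' (\<lambda>i\<in>{1..Suc m}. \<xi> i \<omega>)" if \<omega>: "\<omega> \<in> \<Omega>" for \<omega>
  proof -
    have "restrict (\<lambda>i\<in>{1..Suc m}. \<xi> i \<omega>) {1..m} = (\<lambda>i\<in>{1..m}. \<xi> i \<omega>)"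
      by (auto simp: restrict_def)
    then show ?thesis using X_Suc[of m \<omega>] step.hyps \<omega> by (simp add: F'_def X)
  qed
  ultimately show ?case by blast
qed

text \<open>
  Countability of the state space makes the finite product of its counting spaces discrete, so that
  the function of the past obtained above is automatically measurable. The independence is stated
  for probabilities of events because \<open>X m\<close> agrees with that function only on \<open>space M\<close>.
\<close>

lemma (in prob_space) random_recursion_indep:
  assumes S: "countable S"
    and ind: "indep_vars (\<lambda>_. count_space S) \<xi> {1..}"
    and f: "\<And>a b. a \<in> S \<Longrightarrow> b \<in> S \<Longrightarrow> f a b \<in> S"
    and X_1: "\<And>\<omega>. \<omega> \<in> space M \<Longrightarrow> X 1 \<omega> = \<xi> 1 \<omega>"
    and X_Suc: "\<And>m \<omega>. 1 \<le> m \<Longrightarrow> \<omega> \<in> space M \<Longrightarrow> X (m + 1) \<omega> = f (X m \<omega>) (\<xi> (m + 1) \<omega>)"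
    and m: "1 \<le> (m::nat)"
  shows "random_variable (count_space S) (X m)"
    and "a \<in> S \<Longrightarrow> b \<in> S \<Longrightarrow>
      \<P>(\<omega> in M. X m \<omega> = a \<and> \<xi> (m + 1) \<omega> = b)
        = \<P>(\<omega> in M. X m \<omega> = a) * \<P>(\<omega> in M. \<xi> (m + 1) \<omega> = b)"
proof -
  have rv: "random_variable (count_space S) (\<xi> i)" if "1 \<le> i" for i
    using ind that by (auto simp: indep_vars_def)
  have "\<xi> i \<omega> \<in> S" if "1 \<le> i" "\<omega> \<in> space M" for i \<omega>
    using measurable_space[OF rv[OF that(1)] that(2)] by simp
  then obtain F where F: "F \<in> (\<Pi>\<^sub>E i\<in>{1..m}. S) \<rightarrow> S"
    and X: "\<And>\<omega>. \<omega> \<in> space M \<Longrightarrow> X m \<omega> = F (\<lambda>i\<in>{1..m}. \<xi> i \<omega>)"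
    using random_recursion_factors[of "space M" \<xi> S f X m] f X_1 X_Suc m by auto
  let ?past = "\<lambda>\<omega>. \<lambda>i\<in>{1..m}. \<xi> i \<omega>" and ?next = "\<lambda>\<omega>. \<lambda>i\<in>{m + 1}. \<xi> i \<omega>"
  have F_meas: "F \<in> measurable (\<Pi>\<^sub>M i\<in>{1..m}. count_space S) (count_space S)"
    using F S by (simp add: count_space_PiM_finite)
  have "indep_var (\<Pi>\<^sub>M i\<in>{1..m}. count_space S) ?past (\<Pi>\<^sub>M i\<in>{m + 1}. count_space S) ?next"
    by (rule indep_var_restrict[OF ind]) auto
  then have ind': "indep_var (count_space S) (F \<circ> ?past) (count_space S) ((\<lambda>x. x (m + 1)) \<circ> ?next)"
    by (rule indep_var_compose[OF _ F_meas measurable_component_singleton]) simp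
  have "random_variable (count_space S) (F \<circ> ?past)"
    using ind' by (rule indep_var_rv1)
  then show "random_variable (count_space S) (X m)"
    by (rule subst[OF measurable_cong, rotated]) (simp add: X)
  have "(\<lambda>\<omega>. ((F \<circ> ?past) \<omega>, ((\<lambda>x. x (m + 1)) \<circ> ?next) \<omega>)) -` ({a} \<times> {b}) \<inter> space M
      = {\<omega> \<in> space M. X m \<omega> = a \<and> \<xi> (m + 1) \<omega> = b}"
    and "(F \<circ> ?past) -` {a} \<inter> space M = {\<omega> \<in> space M. X m \<omega> = a}"
    and "((\<lambda>x. x (m + 1)) \<circ> ?next) -` {b} \<inter> space M = {\<omega> \<in> space M. \<xi> (m + 1) \<omega> = b}"
    by (auto simp: X)
  then show "\<P>(\<omega> in M. X m \<omega> = a \<and> \<xi> (m + 1) \<omega> = b)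
        = \<P>(\<omega> in M. X m \<omega> = a) * \<P>(\<omega> in M. \<xi> (m + 1) \<omega> = b)"
    if "a \<in> S" "b \<in> S"
    using indep_varD[OF ind', of "{a}" "{b}"] that by simp
qed

section \<open>Convergence of the random walk\<close>

lemma (in prob_space) sum_prob_singletons:
  assumes "finite S" and Y: "random_variable (count_space S) Y"
  shows "(\<Sum>g\<in>S. \<P>(\<omega> in M. Y \<omega> = g)) = 1"
proof -
  have "{\<omega> \<in> space M. Y \<omega> = g} = Y -` {g} \<inter> space M" for g by auto
  then have "{\<omega> \<in> space M. Y \<omega> = g} \<in> events" if "g \<in> S" for g
    using measurable_sets[OF Y, of "{g}"] that by simp
  then have "prob (\<Union>g\<in>S. {\<omega> \<in> space M. Y \<omega> = g}) = (\<Sum>g\<in>S. \<P>(\<omega> in M. Y \<omega> = g))"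
    using assms(1) by (intro finite_measure_finite_Union) (auto simp: disjoint_family_on_def)
  moreover have "(\<Union>g\<in>S. {\<omega> \<in> space M. Y \<omega> = g}) = space M"
    using measurable_space[OF Y] by auto
  ultimately show ?thesis by (simp add: prob_space)
qed

lemma measure_law_singleton:
  assumes "Y \<in> measurable M (count_space (carrier G))" and "g \<in> carrier G"
  shows "measure (law M G Y) {g} = \<P>(\<omega> in M. Y \<omega> = g)"
  using assms by (simp add: law_def measure_distr vimage_def Int_def conj_commute)

theorem theorem2:
  fixes G :: "('a, 'b) monoid_scheme"
    and M :: "'w measure"
    and \<xi> X :: "nat \<Rightarrow> 'w \<Rightarrow> 'a"
  assumes "group G"
    and "finite (carrier G)"
    and "prob_space M"
    and "prob_space.indep_vars M (\<lambda>_. count_space (carrier G)) \<xi> {1..}"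
    and "\<And>i j. i \<ge> 1 \<Longrightarrow> j \<ge> 1 \<Longrightarrow> law M G (\<xi> i) = law M G (\<xi> j)"
    and "\<And>m g. m \<ge> 1 \<Longrightarrow> g \<in> carrier G \<Longrightarrow> measure M {\<omega> \<in> space M. \<xi> m \<omega> = g} > 0"
    and "\<And>\<omega>. \<omega> \<in> space M \<Longrightarrow> X 1 \<omega> = \<xi> 1 \<omega>"
    and "\<And>m \<omega>. m \<ge> 1 \<Longrightarrow> \<omega> \<in> space M \<Longrightarrow> X (m + 1) \<omega> = X m \<omega> \<otimes>\<^bsub>G\<^esub> \<xi> (m + 1) \<omega>"
  shows "\<exists>L. laws_tendsto G (\<lambda>m. law M G (X m)) L \<and> L = uniform_count_measure (carrier G)"
proof -
  interpret group G by fact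
  interpret prob_space M by fact
  note fin = assms(2)
  have ne: "carrier G \<noteq> {}" by auto
  note indep = random_recursion_indep[where f = "(\<otimes>\<^bsub>G\<^esub>)" and X = X,
      OF countable_finite[OF fin] assms(4) _ assms(7,8)]
  have rv_\<xi>: "random_variable (count_space (carrier G)) (\<xi> m)" if "1 \<le> m" for m
    using assms(4) that by (auto simp: indep_vars_def)
  have rv_X: "random_variable (count_space (carrier G)) (X m)" if "1 \<le> m" for m
    using indep(1) that by simp
  define q where "q = (\<lambda>g. \<P>(\<omega> in M. \<xi> 1 \<omega> = g))"
  have q: "\<P>(\<omega> in M. \<xi> m \<omega> = g) = q g" if "1 \<le> m" "g \<in> carrier G" for m g
    using assms(5)[of m 1] that measure_law_singleton[OF rv_\<xi>[of m] that(2)]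
      measure_law_singleton[OF rv_\<xi>[of 1] that(2)] by (simp add: q_def)
  \<comment> \<open>The walk starts at time \<open>1\<close>, so the time index is shifted.\<close>
  define p where "p = (\<lambda>m g. \<P>(\<omega> in M. X (m + 1) \<omega> = g))"
  have rec: "p (Suc m) g = (\<Sum>h\<in>carrier G. p m h * q (inv\<^bsub>G\<^esub> h \<otimes>\<^bsub>G\<^esub> g))"
    if g: "g \<in> carrier G" for m g
  proof -
    let ?E = "\<lambda>h. {\<omega> \<in> space M. X (m + 1) \<omega> = h \<and> \<xi> (m + 1 + 1) \<omega> = inv\<^bsub>G\<^esub> h \<otimes>\<^bsub>G\<^esub> g}"
    have X_in: "X (m + 1) \<omega> \<in> carrier G" and \<xi>_in: "\<xi> (m + 1 + 1) \<omega> \<in> carrier G"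
      if "\<omega> \<in> space M" for \<omega>
      using measurable_space[OF rv_X that, of "m + 1"] measurable_space[OF rv_\<xi> that, of "m + 1 + 1"]
      by simp_all
    have ev: "?E h \<in> events" if "h \<in> carrier G" for h
    proof -
      have "?E h = (X (m + 1) -` {h} \<inter> space M) \<inter> (\<xi> (m + 1 + 1) -` {inv\<^bsub>G\<^esub> h \<otimes>\<^bsub>G\<^esub> g} \<inter> space M)"
        by auto
      then show ?thesis
        using measurable_sets[OF rv_X, of "m + 1" "{h}"] that g
          measurable_sets[OF rv_\<xi>, of "m + 1 + 1" "{inv\<^bsub>G\<^esub> h \<otimes>\<^bsub>G\<^esub> g}"] by simp
    qed
    \<comment> \<open>From the position \<open>h\<close>, exactly one step leads to \<open>g\<close>.\<close>
    have "{\<omega> \<in> space M. X (m + 1 + 1) \<omega> = g} = (\<Union>h\<in>carrier G. ?E h)"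
    proof -
      have "X (m + 1 + 1) \<omega> = g \<longleftrightarrow> \<xi> (m + 1 + 1) \<omega> = inv\<^bsub>G\<^esub> (X (m + 1) \<omega>) \<otimes>\<^bsub>G\<^esub> g"
        if "\<omega> \<in> space M" for \<omega>
        using assms(8)[of "m + 1" \<omega>] that
          inv_solve_left[OF \<xi>_in[OF that] X_in[OF that] g] by auto
      then show ?thesis using X_in by auto
    qed
    then have "p (Suc m) g = prob (\<Union>h\<in>carrier G. ?E h)"
      by (simp add: p_def)
    also have "\<dots> = (\<Sum>h\<in>carrier G. prob (?E h))"
      using fin ev by (intro finite_measure_finite_Union) (auto simp: disjoint_family_on_def)
    also have "\<dots> = (\<Sum>h\<in>carrier G. p m h * q (inv\<^bsub>G\<^esub> h \<otimes>\<^bsub>G\<^esub> g))"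
    proof (rule sum.cong[OF refl])
      fix h assume h: "h \<in> carrier G"
      have "prob (?E h) = \<P>(\<omega> in M. X (m + 1) \<omega> = h)
          * \<P>(\<omega> in M. \<xi> (m + 1 + 1) \<omega> = inv\<^bsub>G\<^esub> h \<otimes>\<^bsub>G\<^esub> g)"
        using indep(2)[of "m + 1" h "inv\<^bsub>G\<^esub> h \<otimes>\<^bsub>G\<^esub> g"] h g by simp
      also have "\<dots> = p m h * q (inv\<^bsub>G\<^esub> h \<otimes>\<^bsub>G\<^esub> g)"
        using q[of "m + 1 + 1" "inv\<^bsub>G\<^esub> h \<otimes>\<^bsub>G\<^esub> g"] h g by (simp add: p_def)
      finally show "prob (?E h) = p m h * q (inv\<^bsub>G\<^esub> h \<otimes>\<^bsub>G\<^esub> g)" .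
    qed
    finally show ?thesis .
  qed
  have p_lim: "(\<lambda>m. p m g) \<longlonglongrightarrow> 1 / real (card (carrier G))" if "g \<in> carrier G" for g
    using fin _ _ _ rec that
  proof (rule convolution_recurrence_tendsto_uniform)
    show "(\<Sum>h\<in>carrier G. p m h) = 1" for m
      unfolding p_def by (intro sum_prob_singletons fin rv_X) simp
    show "(\<Sum>h\<in>carrier G. q h) = 1"
      unfolding q_def by (intro sum_prob_singletons fin rv_\<xi>) simp
    show "0 < q h" if "h \<in> carrier G" for h
      using assms(6)[of 1 h] that by (simp add: q_def)
  qed
  have "(\<lambda>m. measure (law M G (X m)) {g}) \<longlonglongrightarrow> measure (uniform_count_measure (carrier G)) {g}"
    if g: "g \<in> carrier G" for g
  proof -
    have "(\<lambda>m. measure (law M G (X (m + 1))) {g}) \<longlonglongrightarrow> 1 / real (card (carrier G))"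
      using p_lim[OF g] measure_law_singleton[OF rv_X g] by (simp add: p_def)
    then have "(\<lambda>m. measure (law M G (X m)) {g}) \<longlonglongrightarrow> 1 / real (card (carrier G))"
      by (rule LIMSEQ_offset)
    then show ?thesis using fin g by (simp add: measure_uniform_count_measure)
  qed
  then have "laws_tendsto G (\<lambda>m. law M G (X m)) (uniform_count_measure (carrier G))"
    unfolding laws_tendsto_def
    using prob_space_uniform_count_measure[OF fin ne] by (simp add: sets_uniform_count_measure)
  then show ?thesis by blast
qed

end
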